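(* In each item below, the real and complex minimum positive semidefinite ranks of the indicated graph coincide, and their common value $\mathrm{mr}_+$ is as stated. In items (1), (2), (3), (5), (6), $T$ and $T'$ are trees of order $m\ge2$ and $m'\ge2$, respectively; $K_r$ denotes the complete graph on $r\ge 2$ vertices and $C_r$ the cycle on $r\ge3$ vertices. (1) $\mathrm{mr}_+(T\circ T')=mm'-1$. (2) $\mathrm{mr}_+(T\circ K_n)=2m-1$ for $n\ge2$. (3) $\mathrm{mr}_+(K_n\circ T)=nm-n+1$. (4) $\mathrm{mr}_+(K_n\circ K_m)=n+1$. (5) $\mathrm{mr}_+(C_n\circ T)=nm-2$. (6) $\mathrm{mr}_+(T\circ C_n)=m(n-1)-1$. (7) $\mathrm{mr}_+(C_n\circ K_m)=2n-2$. (8) $\mathrm{mr}_+(K_m\circ C_n)=m(n-2)+1$. (9) $\mathrm{mr}_+(C_n\circ C_m)=n(m-1)-2$.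
   Context: All graphs are finite and simple. For an $N\times N$ Hermitian matrix $A$, $\mathcal{G}(A)$ is the simple graph on $\{1,\dots,N\}$ in which distinct $i,j$ are adjacent iff $A_{ij}\ne0$ (the diagonal is unconstrained). For a graph $G$ on $N$ vertices, $\mathrm{mr}_+^{\mathbb{R}}(G)$ (resp. $\mathrm{mr}_+^{\mathbb{C}}(G)$) is the minimum rank of a real symmetric (resp. complex Hermitian) positive semidefinite $N\times N$ matrix $B$ with $\mathcal{G}(B)=G$. If the two numbers are equal, the common value is denoted $\mathrm{mr}_+(G)$. The corona product $G_1\circ G_2$ of $G_1=(V_1,E_1)$ with $G_2=(V_2,E_2)$ is the graph of order $|V_1||V_2|+|V_1|$ obtained by taking one copy of $G_1$ and $|V_1|$ copies of $G_2$, and joining every vertex of the $i$th copy of $G_2$ to the $i$th vertex of $G_1$. *)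

theory Defs
  imports
    "Graph_Theory.Graph_Theory"
    "Jordan_Normal_Form.Schur_Decomposition"
    "Jordan_Normal_Form.DL_Rank"
begin

text \<open>
  A finite simple graph is a \<^locale>\<open>pair_graph\<close>: a finite, loop-free digraph
  whose arc set is a symmetric relation, each edge being the two arcs \<open>(u, v)\<close> and \<open>(v, u)\<close>.
\<close>

text \<open>
  The library's \<^const>\<open>tree\<close> is meant for digraphs without antiparallel arcs: in a symmetric
  digraph every edge gives a directed cycle of length 2. Cycles of the underlying undirected
  graph are the directed cycles of length at least 3.
\<close>

definition tree_graph :: "'a pair_pre_digraph \<Rightarrow> bool" where
  "tree_graph G \<longleftrightarrow> pair_graph G \<and> connected (with_proj G) \<and>
     \<not> (\<exists>p. pre_digraph.cycle (with_proj G) p \<and> 3 \<le> length p)"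

definition cycle_graph :: "nat \<Rightarrow> 'a pair_pre_digraph \<Rightarrow> bool" where
  "cycle_graph n G \<longleftrightarrow> 3 \<le> n \<and>
     (\<exists>v. inj_on v {..<n} \<and> pverts G = v ` {..<n} \<and>
        parcs G = (\<Union>i<n. {(v i, v (Suc i mod n)), (v (Suc i mod n), v i)}))"

text \<open>
  \<open>Inl u\<close> is the vertex \<open>u\<close> of the copy of \<open>G\<close>, and \<open>Inr (u, x)\<close> is the vertex \<open>x\<close> of the copy
  of \<open>H\<close> belonging to \<open>u\<close>.
\<close>

definition corona :: "'a pair_pre_digraph \<Rightarrow> 'b pair_pre_digraph \<Rightarrow> ('a + 'a \<times> 'b) pair_pre_digraph"
    (infixl \<open>\<odot>\<close> 70) where
  "G \<odot> H = \<lparr>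
     pverts = Inl ` pverts G \<union> Inr ` (pverts G \<times> pverts H),
     parcs = {(Inl u, Inl v) | u v. (u, v) \<in> parcs G}
       \<union> {(Inr (u, x), Inr (u, y)) | u x y. u \<in> pverts G \<and> (x, y) \<in> parcs H}
       \<union> {(Inl u, Inr (u, x)) | u x. u \<in> pverts G \<and> x \<in> pverts H}
       \<union> {(Inr (u, x), Inl u) | u x. u \<in> pverts G \<and> x \<in> pverts H} \<rparr>"

lemma card_pverts_corona:
  assumes "finite (pverts G)" "finite (pverts H)"
  shows "card (pverts (G \<odot> H)) = card (pverts G) * card (pverts H) + card (pverts G)"
proof -
  have "card (Inl ` pverts G \<union> Inr ` (pverts G \<times> pverts H)) =
      card (Inl ` pverts G :: ('a + 'a \<times> 'b) set) +
      card (Inr ` (pverts G \<times> pverts H) :: ('a + 'a \<times> 'b) set)"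
    using assms by (intro card_Un_disjoint) auto
  then show ?thesis
    by (simp add: corona_def card_image card_cartesian_product)
qed

lemma pair_graph_corona:
  assumes "pair_graph G" "pair_graph H"
  shows "pair_graph (G \<odot> H)"
proof -
  interpret G: pair_graph G by fact
  interpret H: pair_graph H by fact
  have symG: "(v, u) \<in> parcs G" if "(u, v) \<in> parcs G" for u v
    using G.arcs_symmetric that by blast
  have symH: "(v, u) \<in> parcs H" if "(u, v) \<in> parcs H" for u v
    using H.arcs_symmetric that by blast
  have wf: "parcs (G \<odot> H) \<subseteq> pverts (G \<odot> H) \<times> pverts (G \<odot> H)"
    by (auto simp: corona_def dest: G.wellformed' H.wellformed')
  have fin: "finite (pverts (G \<odot> H))"
    using G.pair_finite_verts H.pair_finite_verts by (simp add: corona_def)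
  have "finite (parcs (G \<odot> H))"
    using finite_subset[OF wf] fin by blast
  moreover have "symmetric (with_proj (G \<odot> H))"
    by (auto simp: symmetric_def corona_def intro!: symI dest: symG symH)
  moreover have "fst e \<noteq> snd e" if "e \<in> parcs (G \<odot> H)" for e
    using that G.pair_no_loops H.pair_no_loops by (fastforce simp: corona_def)
  ultimately show ?thesis
    using wf fin by unfold_locales auto
qed

text \<open>Matrix indices, hence the vertices of the graph of a matrix, start at 0.\<close>

definition mat_graph :: "'f::zero mat \<Rightarrow> nat pair_pre_digraph" where
  "mat_graph A = \<lparr>
     pverts = {..<dim_row A},
     parcs = {(i, j). i < dim_row A \<and> j < dim_row A \<and> i \<noteq> j \<and> A $$ (i, j) \<noteq> 0} \<rparr>"

text \<open>
  Over the reals \<^const>\<open>conjugate\<close> is the identity, so the Hermitian matrices are the symmetric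
  ones. Over the complex numbers \<open>0 \<le> z\<close> means that \<open>z\<close> is real and nonnegative.
\<close>

definition hermitian_mat :: "'f::conjugatable_field mat \<Rightarrow> bool" where
  "hermitian_mat A \<longleftrightarrow> square_mat A \<and> mat_adjoint A = A"

definition psd_mat :: "'f::conjugatable_ordered_field mat \<Rightarrow> bool" where
  "psd_mat A \<longleftrightarrow> hermitian_mat A \<and> (\<forall>x \<in> carrier_vec (dim_row A). 0 \<le> (A *\<^sub>v x) \<bullet>c x)"

text \<open>
  The vertices of \<open>G\<close> may have any type, so the graph of the matrix is only required to be
  isomorphic to \<open>G\<close>, that is, equal to \<open>G\<close> after some numbering of the vertices of \<open>G\<close>.
\<close>

definition mr_plus :: "'f::conjugatable_ordered_field itself \<Rightarrow> 'a pair_pre_digraph \<Rightarrow> nat" where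
  "mr_plus F G = (LEAST r. \<exists>B :: 'f mat. B \<in> carrier_mat (card (pverts G)) (card (pverts G)) \<and>
     psd_mat B \<and> digraph_iso (with_proj (mat_graph B)) (with_proj G) \<and>
     vec_space.rank (card (pverts G)) B = r)"

abbreviation mr_plus_real :: "'a pair_pre_digraph \<Rightarrow> nat" where
  "mr_plus_real \<equiv> mr_plus TYPE(real)"

abbreviation mr_plus_complex :: "'a pair_pre_digraph \<Rightarrow> nat" where
  "mr_plus_complex \<equiv> mr_plus TYPE(complex)"

text \<open>The two minimum ranks coincide and their common value is \<open>r\<close>.\<close>

definition has_mr_plus :: "'a pair_pre_digraph \<Rightarrow> nat \<Rightarrow> bool" where
  "has_mr_plus G r \<longleftrightarrow> mr_plus_real G = r \<and> mr_plus_complex G = r"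

end

theory Submission
  imports Defs
begin

text \<open>
  The Gram matrix of an orthogonal representation of \<open>G\<close> by integer vectors of length \<open>k\<close> is
  positive semidefinite of rank at most \<open>k\<close> and has graph \<open>G\<close>. For the lower bound,
  an OS-set of \<open>G\<close> (vertices \<open>v\<^sub>1, \<dots>, v\<^sub>k\<close> such that some \<open>w\<^sub>i\<close> outside \<open>{v\<^sub>1, \<dots>, v\<^sub>i}\<close> has \<open>v\<^sub>i\<close> as
  its only neighbour in the component of \<open>v\<^sub>i\<close> in \<open>{v\<^sub>1, \<dots>, v\<^sub>i}\<close>) indexes linearly independent
  columns: on a kernel vector supported on the set the quadratic form splits along components, and
  row \<open>w\<^sub>i\<close> kills the entry at \<open>v\<^sub>i\<close>. For trees, complete graphs and cycles the two bounds agree,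
  with a vector \<open>h\<close> orthogonal to none of the representing vectors; mapping each vertex \<open>u\<close> of \<open>G\<close>
  to its own vector together with a copy of \<open>h\<close> in the block of \<open>u\<close> shows that they also agree for
  coronas, where all these numbers add up. Everything is integral, so the field does not matter.
\<close>

section \<open>OS-sets and integer orthogonal representations\<close>

text \<open>
  \<open>C\<close> is any union of components of \<open>S\<close> that contains all neighbours of \<open>v\<close>; this avoids
  talking about paths.
\<close>

inductive ordered_set :: "'a rel \<Rightarrow> 'a set \<Rightarrow> bool" for E where
  empty: "ordered_set E {}"
| insert: "ordered_set E (insert v S)"
    if "ordered_set E S" "v \<notin> S" "w \<notin> insert v S" "C \<subseteq> S"
      "\<And>x y. x \<in> insert v C \<Longrightarrow> y \<in> S - C \<Longrightarrow> (x, y) \<notin> E"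
      "(w, v) \<in> E" "\<And>u. u \<in> C \<Longrightarrow> (w, u) \<notin> E"

lemma finite_ordered_set: "ordered_set E S \<Longrightarrow> finite S"
  by (induction rule: ordered_set.induct) auto

lemma ordered_set_subset_Range: "ordered_set E S \<Longrightarrow> S \<subseteq> Range E"
  by (induction rule: ordered_set.induct) auto

text \<open>Diagonal products are left free, as in the graph of a matrix. The index type is
  arbitrary so that coronas can use a sum type for their coordinates.\<close>

definition represents :: "'i set \<Rightarrow> ('a \<Rightarrow> 'i \<Rightarrow> int) \<Rightarrow> 'a pair_pre_digraph \<Rightarrow> bool" where
  "represents I f G \<longleftrightarrow> (\<forall>u \<in> pverts G. \<forall>v \<in> pverts G. u \<noteq> v \<longrightarrow>
     ((u, v) \<in> parcs G \<longleftrightarrow> (\<Sum>i\<in>I. f u i * f v i) \<noteq> 0))"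

section \<open>Hermitian and positive semidefinite forms\<close>

lemma conjugate_one: "conjugate 1 = (1 :: 'f::{conjugatable_ring, ring_1})"
  by (metis conjugate_dist_mul conjugate_id mult.left_neutral mult.right_neutral)

text \<open>Makes the Gram matrix of integer vectors Hermitian for every conjugation.\<close>

lemma conjugate_of_int: "conjugate (of_int k :: 'f::{conjugatable_ring, ring_1}) = of_int k"
proof -
  have "conjugate (of_nat n :: 'f) = of_nat n" for n
    by (induction n) (simp_all add: conjugate_one conjugate_dist_add)
  then show ?thesis
    by (cases k rule: int_cases2) (simp_all add: conjugate_neg)
qed

text \<open>Arguments are functions on indices, so that splitting a vector by its support is a mere
  case distinction; only values below \<open>dim_row B\<close> matter.\<close>

definition form :: "'f::conjugatable_ordered_field mat \<Rightarrow> (nat \<Rightarrow> 'f) \<Rightarrow> (nat \<Rightarrow> 'f) \<Rightarrow> 'f" where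
  "form B x y = (\<Sum>i<dim_row B. \<Sum>j<dim_row B. B $$ (i, j) * x j * conjugate (y i))"

lemma form_eq_scalar_prod:
  assumes "B \<in> carrier_mat n n"
  shows "form B x y = (B *\<^sub>v vec n x) \<bullet>c vec n y"
  using assms by (simp add: form_def scalar_prod_def sum_distrib_right atLeast0LessThan)

lemma hermitian_mat_iff:
  "hermitian_mat B \<longleftrightarrow> dim_col B = dim_row B \<and>
     (\<forall>i<dim_row B. \<forall>j<dim_row B. B $$ (j, i) = conjugate (B $$ (i, j)))"
proof (cases "dim_col B = dim_row B")
  case True
  have entry: "mat_adjoint B $$ (j, i) = conjugate (B $$ (i, j))"
    if "i < dim_row B" "j < dim_row B" for i j
    using that True by (simp add: mat_adjoint_def mat_of_rows_index)
  have dim: "dim_row (mat_adjoint B) = dim_row B" "dim_col (mat_adjoint B) = dim_row B"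
    using True by (simp_all add: mat_adjoint_def)
  have "mat_adjoint B = B \<longleftrightarrow>
      (\<forall>i<dim_row B. \<forall>j<dim_row B. mat_adjoint B $$ (i, j) = B $$ (i, j))"
    unfolding mat_eq_iff dim True by simp
  also have "\<dots> \<longleftrightarrow> (\<forall>i<dim_row B. \<forall>j<dim_row B. B $$ (j, i) = conjugate (B $$ (i, j)))"
    using entry by metis
  finally show ?thesis
    using True by (simp add: hermitian_mat_def)
qed (simp add: hermitian_mat_def)

lemma psd_mat_form_nonneg:
  assumes "psd_mat B"
  shows "0 \<le> form B x x"
proof -
  have B: "B \<in> carrier_mat (dim_row B) (dim_row B)"
    using assms by (intro carrier_matI) (simp_all add: psd_mat_def hermitian_mat_def)
  have "0 \<le> (B *\<^sub>v vec (dim_row B) x) \<bullet>c vec (dim_row B) x"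
    using assms unfolding psd_mat_def by simp
  then show ?thesis
    by (simp only: form_eq_scalar_prod[OF B])
qed

lemma form_add_left: "form B (\<lambda>i. x i + x' i) y = form B x y + form B x' y"
  by (simp add: form_def algebra_simps sum.distrib)

lemma form_add_right: "form B x (\<lambda>i. y i + y' i) = form B x y + form B x y'"
  by (simp add: form_def algebra_simps sum.distrib conjugate_dist_add)

lemma form_scale_left: "form B (\<lambda>i. c * x i) y = c * form B x y"
  by (simp add: form_def sum_distrib_left algebra_simps)

lemma form_scale_right: "form B x (\<lambda>i. c * y i) = conjugate c * form B x y"
  by (simp add: form_def sum_distrib_left algebra_simps conjugate_dist_mul)

lemma form_commute:
  assumes "hermitian_mat B"
  shows "form B y x = conjugate (form B x y)"
proof -
  have herm: "B $$ (j, i) = conjugate (B $$ (i, j))" if "i < dim_row B" "j < dim_row B" for i j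
    using assms that unfolding hermitian_mat_iff by blast
  have "form B y x = (\<Sum>j<dim_row B. \<Sum>i<dim_row B. B $$ (i, j) * y j * conjugate (x i))"
    unfolding form_def by (rule sum.swap)
  also have "\<dots> = (\<Sum>j<dim_row B. \<Sum>i<dim_row B. conjugate (B $$ (j, i) * x i * conjugate (y j)))"
    by (intro sum.cong refl, subst herm) (simp_all add: conjugate_dist_mul)
  also have "\<dots> = conjugate (form B x y)"
    by (simp add: form_def sum_conjugate)
  finally show ?thesis .
qed

lemma form_unit_right:
  assumes "i < dim_row B"
  shows "form B x (\<lambda>k. of_bool (k = i)) = (\<Sum>j<dim_row B. B $$ (i, j) * x j)"
proof -
  have "form B x (\<lambda>k. of_bool (k = i)) =
      (\<Sum>k<dim_row B. if k = i then \<Sum>j<dim_row B. B $$ (i, j) * x j else 0)"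
    unfolding form_def by (intro sum.cong refl) (auto simp: conjugate_one)
  then show ?thesis
    using assms by (simp add: sum.delta)
qed

lemma psd_mat_isotropic:
  assumes "psd_mat B" "form B y y = 0"
  shows "form B y z = 0"
proof -
  \<comment> \<open>The form at \<open>(b + 1) y - a z\<close> is \<open>- |a|\<^sup>2 (b + 2)\<close>, which forces \<open>a = 0\<close>.\<close>
  define a where "a = form B y z"
  define b where "b = form B z z"
  have herm: "hermitian_mat B"
    using assms by (simp add: psd_mat_def)
  have zy: "form B z y = conjugate a"
    using form_commute[OF herm] a_def by blast
  have bb: "conjugate b = b"
    unfolding b_def using form_commute[OF herm] by metis
  define N where "N = a * conjugate a"
  have N: "0 \<le> N"
    unfolding N_def by (rule conjugate_square_positive)
  \<comment> \<open>Evaluating the form at \<open>a z\<close> shows \<open>N * b\<close> nonnegative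
    from positivity alone; no inequalities are multiplied.\<close>
  have "0 \<le> form B (\<lambda>i. a * z i) (\<lambda>i. a * z i)"
    using assms(1) by (rule psd_mat_form_nonneg)
  then have X: "0 \<le> N * b"
    by (simp add: form_scale_left form_scale_right b_def[symmetric] N_def mult_ac)
  let ?x = "\<lambda>i. (b + 1) * y i + (- a) * z i"
  have "0 \<le> form B ?x ?x"
    using assms(1) by (rule psd_mat_form_nonneg)
  also have "form B ?x ?x = - (N * b + N + N)"
    unfolding form_add_left form_add_right form_scale_left form_scale_right
    unfolding zy a_def[symmetric] b_def[symmetric] assms(2)
    by (simp add: bb conjugate_one conjugate_dist_add conjugate_neg N_def algebra_simps)
  finally have "0 \<le> - (N * b + N + N)" .
  then have "N * b + N + N \<le> 0"
    by (metis add.inverse_inverse add.right_neutral add_left_mono right_minus add.commute)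
  moreover have "N \<le> N * b + N + N"
    using add_mono[OF add_mono[OF X N] order_refl[of N]] by simp
  ultimately have "N = 0"
    using N by simp
  then show ?thesis
    by (simp add: N_def a_def)
qed

section \<open>Lower bound: columns indexed by an OS-set\<close>

text \<open>The last insertion is undone first: the entry at \<open>v\<close> is shown to vanish,
  which shrinks the support from \<open>insert v S\<close> to \<open>S\<close>.\<close>

lemma kernel_ordered_set:
  fixes B :: "'f::conjugatable_ordered_field mat"
  assumes "ordered_set E S" and "psd_mat B"
    and bij: "bij_betw p {..<dim_row B} V" and "E \<subseteq> V \<times> V"
    and arcs: "\<And>i j. i < dim_row B \<Longrightarrow> j < dim_row B \<Longrightarrow>
      (p i, p j) \<in> E \<longleftrightarrow> i \<noteq> j \<and> B $$ (i, j) \<noteq> 0"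
    and "\<And>i. i < dim_row B \<Longrightarrow> (\<Sum>j<dim_row B. B $$ (i, j) * x j) = 0"
    and "\<And>i. i < dim_row B \<Longrightarrow> p i \<notin> S \<Longrightarrow> x i = 0"
    and "i < dim_row B"
  shows "x i = 0"
  using assms(1,6-)
proof (induction arbitrary: i rule: ordered_set.induct)
  case empty
  then show ?case by simp
next
  case (insert S v w C)
  define n where "n = dim_row B"
  have pinj: "p i = p j \<longleftrightarrow> i = j" if "i < n" "j < n" for i j
    using bij that by (auto simp: n_def bij_betw_def dest: inj_onD)
  obtain i0 k where i0: "i0 < n" "p i0 = v" and k: "k < n" "p k = w"
    using insert.hyps(6) assms(4) bij unfolding bij_betw_def n_def by (auto simp: image_iff)
  \<comment> \<open>\<open>y\<close> is the part of \<open>x\<close> on \<open>v\<close> and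
    \<open>C\<close>, \<open>z\<close> the rest. No arc joins their supports, so the mixed terms of
    the form vanish; as \<open>x\<close> lies in the kernel, \<open>y\<close> is isotropic.\<close>
  define y where "y j = (if p j \<in> insert v C then x j else 0)" for j
  define z where "z j = (if p j \<in> insert v C then 0 else x j)" for j
  have x: "x = (\<lambda>j. y j + z j)"
    by (auto simp: y_def z_def)
  have Bx: "form B x u = 0" for u
  proof -
    have "form B x u = (\<Sum>i<n. (\<Sum>j<n. B $$ (i, j) * x j) * conjugate (u i))"
      by (simp add: form_def n_def sum_distrib_right)
    then show ?thesis
      using insert.prems(1) by (simp add: n_def)
  qed
  have yz: "form B y z = 0"
    unfolding form_def n_def[symmetric]
  proof (intro sum.neutral ballI)
    fix i j assume "i \<in> {..<n}" "j \<in> {..<n}"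
    then have ij: "i < n" "j < n" by auto
    show "B $$ (i, j) * y j * conjugate (z i) = 0"
    proof (cases "y j = 0 \<or> z i = 0")
      case False
      then have "p j \<in> insert v C" "p i \<in> S - C"
        using insert.prems(2) ij by (auto simp: y_def z_def n_def split: if_splits)
      then have "(p j, p i) \<notin> E" "i \<noteq> j"
        using insert.hyps(2,5) by auto
      then have "B $$ (j, i) = 0"
        using arcs ij by (auto simp: n_def)
      moreover have "B $$ (i, j) = conjugate (B $$ (j, i))"
        using \<open>psd_mat B\<close> ij unfolding psd_mat_def hermitian_mat_iff n_def by blast
      ultimately show ?thesis by simp
    qed auto
  qed
  have "form B z y = 0"
    using yz form_commute[of B y z] \<open>psd_mat B\<close> by (simp add: psd_mat_def)
  moreover have "form B x y = form B y y + form B z y"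
    by (subst x) (rule form_add_left)
  ultimately have "form B y y = 0"
    using Bx[of y] by simp
  \<comment> \<open>Pairing with the unit vector at \<open>k\<close> reads off the row of
    \<open>w\<close>.\<close>
  then have "form B y (\<lambda>i. of_bool (i = k)) = 0"
    by (rule psd_mat_isotropic[OF \<open>psd_mat B\<close>])
  then have "(\<Sum>j<n. B $$ (k, j) * y j) = 0"
    using form_unit_right[of k B y] k by (simp add: n_def)
  \<comment> \<open>In this row only the column of \<open>v\<close> survives: \<open>w\<close> has
    no neighbour in \<open>C\<close>, and \<open>w\<close> itself is outside the support of
    \<open>y\<close>, so its diagonal entry is harmless.\<close>
  moreover have "B $$ (k, j) * y j = (if j = i0 then B $$ (k, i0) * x i0 else 0)" if "j < n" for j
  proof (cases "p j \<in> C")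
    case True
    then have "(p k, p j) \<notin> E" "k \<noteq> j" "j \<noteq> i0"
      using insert.hyps(2,3,4,7) k i0 by auto
    then show ?thesis
      using arcs that k by (auto simp: n_def)
  next
    case False
    then show ?thesis
      using i0 pinj[OF that i0(1)] by (auto simp: y_def)
  qed
  ultimately have "B $$ (k, i0) * x i0 = 0"
    using i0 by (simp add: sum.delta)
  moreover have "B $$ (k, i0) \<noteq> 0"
    using insert.hyps(6) k i0 arcs by (auto simp: n_def)
  ultimately have "x i0 = 0"
    by simp
  then have "x j = 0" if "j < n" "p j \<notin> S" for j
    using insert.prems(2)[of j] that i0 pinj[OF that(1) i0(1)] by (auto simp: n_def)
  then show ?case
    using insert.IH[OF insert.prems(1) _ insert.prems(3)] unfolding n_def by blast
qed

section \<open>Rank bounds for matrices\<close>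

lemma rank_ge_card_columns:
  fixes B :: "'f::field mat"
  assumes B: "B \<in> carrier_mat n nc" and J: "J \<subseteq> {..<nc}"
    and inj: "\<And>x j. \<lbrakk>\<And>i. i < n \<Longrightarrow> (\<Sum>j\<in>J. B $$ (i, j) * x j) = 0; j \<in> J\<rbrakk> \<Longrightarrow> x j = 0"
  shows "card J \<le> vec_space.rank n B"
proof -
  interpret vec_space "TYPE('f)" n .
  have fin: "finite J"
    using J finite_subset by blast
  have idx: "col B j $ i = B $$ (i, j)" if "j \<in> J" "i < n" for i j
    using that J B by auto
  \<comment> \<open>Independence concerns sets of vectors, so repeated columns must be excluded
    first; two equal ones would give the kernel vector \<open>?x\<close> with entries 1 and
    -1.\<close>
  have injc: "inj_on (col B) J"
  proof (rule inj_onI, rule ccontr)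
    fix j k assume jk: "j \<in> J" "k \<in> J" "col B j = col B k" "j \<noteq> k"
    let ?x = "\<lambda>l. of_bool (l = j) - of_bool (l = k) :: 'f"
    have "(\<Sum>l\<in>J. B $$ (i, l) * ?x l) = 0" if "i < n" for i
    proof -
      have "(\<Sum>l\<in>J. B $$ (i, l) * ?x l) =
          (\<Sum>l\<in>J. if l = j then B $$ (i, j) else 0) - (\<Sum>l\<in>J. if l = k then B $$ (i, k) else 0)"
        unfolding sum_subtractf[symmetric] by (intro sum.cong) auto
      also have "\<dots> = 0"
        using jk fin idx[OF jk(1) that] idx[OF jk(2) that] by simp
      finally show ?thesis .
    qed
    from inj[OF this jk(1)] show False
      using jk by simp
  qed
  have "lin_indpt (col B ` J)"
  proof
    assume "lin_dep (col B ` J)"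
    then obtain A a v where A: "finite A" "A \<subseteq> col B ` J" "lincomb a A = 0\<^sub>v n" "v \<in> A" "a v \<noteq> 0"
      by (auto simp: lin_dep_def class_ring_simps)
    \<comment> \<open>Extends the coefficients of a vanishing combination on \<open>A\<close> by
      zero to all of \<open>J\<close>.\<close>
    let ?x = "\<lambda>j. if col B j \<in> A then a (col B j) else 0"
    have "col B j \<in> carrier_vec n" for j
      using col_dim[of B j] carrier_matD(1)[OF B] by simp
    then have cA: "A \<subseteq> carrier_vec n"
      using A(2) by blast
    have "(\<Sum>j\<in>J. B $$ (i, j) * ?x j) = 0" if "i < n" for i
    proof -
      have "(\<Sum>j\<in>J. B $$ (i, j) * ?x j) = (\<Sum>j\<in>J. (\<lambda>c. c $ i * (if c \<in> A then a c else 0)) (col B j))"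
        using idx that by (intro sum.cong) auto
      also have "\<dots> = (\<Sum>c\<in>col B ` J. c $ i * (if c \<in> A then a c else 0))"
        by (simp add: sum.reindex[OF injc])
      also have "\<dots> = (\<Sum>c\<in>A. a c * c $ i)"
        using A(2) fin by (intro sum.mono_neutral_cong_right) auto
      also have "\<dots> = lincomb a A $ i"
        using lincomb_index[OF that cA] by simp
      finally show ?thesis
        using A(3) that by simp
    qed
    moreover obtain j where "j \<in> J" "col B j = v"
      using A(2,4) by auto
    ultimately show False
      using inj[of ?x j] A(4,5) by simp
  qed
  moreover have "col B ` J \<subseteq> set (cols B)"
    using J B by (auto simp: cols_def)
  ultimately show ?thesis
    using rank_ge_card_indpt[OF B, of "col B ` J"] by (simp add: card_image[OF injc])
qed

text \<open>Each index contributes a matrix of product entries, which has rank at most one, and rank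
  is subadditive. Applied to the Gram matrix of a representation, one index per coordinate.\<close>

lemma rank_sum_products_le:
  fixes g h :: "'i \<Rightarrow> nat \<Rightarrow> 'f::field"
  assumes "finite I"
  shows "vec_space.rank n (mat n nc (\<lambda>(i, j). \<Sum>k\<in>I. g k i * h k j)) \<le> card I"
  using assms
proof induction
  case empty
  interpret vec_space "TYPE('f)" n .
  have "mat n nc (\<lambda>(i, j). \<Sum>k\<in>{}. g k i * h k j) = 0\<^sub>m n nc"
    by auto
  then show ?case
    by (simp only: rank_0I)
next
  case (insert k I)
  interpret vec_space "TYPE('f)" n .
  let ?A = "mat n nc (\<lambda>(i, j). g k i * h k j)"
  let ?B = "mat n nc (\<lambda>(i, j). \<Sum>k\<in>I. g k i * h k j)"
  have "mat n nc (\<lambda>(i, j). \<Sum>k\<in>insert k I. g k i * h k j) = ?A + ?B"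
    using insert by (intro eq_matI) auto
  moreover have "rank (?A + ?B) \<le> rank ?A + rank ?B"
    by (rule rank_subadditive) auto
  moreover have "rank ?A \<le> 1"
    by (rule rank_le_1_product_entries[of _ nc "g k" "h k"]) auto
  ultimately show ?case
    using insert by simp
qed

section \<open>Graph isomorphisms and the minimum rank\<close>

text \<open>Library isomorphisms also map arcs, heads and tails. Since arcs here are pairs of
  vertices, a numbering \<open>p\<close> of the vertices determines all of this.\<close>

lemma digraph_iso_mat_graph_iff:
  assumes "pair_graph G"
  shows "digraph_iso (with_proj (mat_graph B)) (with_proj G) \<longleftrightarrow>
    (\<exists>p. bij_betw p {..<dim_row B} (pverts G) \<and>
      (\<forall>i<dim_row B. \<forall>j<dim_row B. (p i, p j) \<in> parcs G \<longleftrightarrow> i \<noteq> j \<and> B $$ (i, j) \<noteq> 0))"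
    (is "?L \<longleftrightarrow> (\<exists>p. ?R p)")
proof
  interpret G: pair_graph G by fact
  assume ?L
  then obtain h where h: "pre_digraph.digraph_isomorphism (with_proj (mat_graph B)) h"
      "with_proj G = app_iso h (with_proj (mat_graph B))"
    by (auto simp: digraph_iso_def)
  define p where "p = iso_verts h"
  define q where "q = iso_arcs h"
  have inj: "inj_on p {..<dim_row B}"
    using h(1) by (simp add: pre_digraph.digraph_isomorphism_def p_def mat_graph_def)
  have V: "pverts G = p ` {..<dim_row B}"
    using arg_cong[OF h(2), of verts] by (simp add: p_def mat_graph_def)
  have E: "parcs G = q ` parcs (mat_graph B)"
    using arg_cong[OF h(2), of arcs] by (simp add: q_def)
  have t: "iso_tail h = fst" "iso_head h = snd"
    using arg_cong[OF h(2), of tail] arg_cong[OF h(2), of head] by simp_all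
  \<comment> \<open>The end maps are the projections, so the arc map must act as \<open>p\<close> on
    both ends.\<close>
  have q: "q (i, j) = (p i, p j)" if "(i, j) \<in> parcs (mat_graph B)" for i j
    using h(1) that t by (force simp: pre_digraph.digraph_isomorphism_def p_def q_def prod_eq_iff)
  have "(p i, p j) \<in> parcs G \<longleftrightarrow> (i, j) \<in> parcs (mat_graph B)"
    if ij: "i < dim_row B" "j < dim_row B" for i j
  proof
    assume "(p i, p j) \<in> parcs G"
    then obtain k l where kl: "(k, l) \<in> parcs (mat_graph B)" "(p i, p j) = q (k, l)"
      unfolding E by auto
    then have "p i = p k" "p j = p l" "k < dim_row B" "l < dim_row B"
      using q by (auto simp: mat_graph_def)
    then show "(i, j) \<in> parcs (mat_graph B)"
      using inj kl(1) ij by (auto simp: inj_on_def)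
  next
    assume "(i, j) \<in> parcs (mat_graph B)"
    then show "(p i, p j) \<in> parcs G"
      using q unfolding E by (metis imageI)
  qed
  then show "\<exists>p. ?R p"
    using inj V by (intro exI[of _ p]) (auto simp: bij_betw_def mat_graph_def)
next
  interpret G: pair_graph G by fact
  assume "\<exists>p. ?R p"
  then obtain p where p: "bij_betw p {..<dim_row B} (pverts G)"
    "\<And>i j. i < dim_row B \<Longrightarrow> j < dim_row B \<Longrightarrow>
      (p i, p j) \<in> parcs G \<longleftrightarrow> i \<noteq> j \<and> B $$ (i, j) \<noteq> 0"
    by auto
  let ?h = "\<lparr>iso_verts = p, iso_arcs = map_prod p p, iso_head = snd, iso_tail = fst\<rparr>"
  have inj: "inj_on p {..<dim_row B}" and V: "p ` {..<dim_row B} = pverts G"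
    using p(1) by (auto simp: bij_betw_def)
  have "wf_digraph (with_proj (mat_graph B))"
    by unfold_locales (auto simp: mat_graph_def)
  moreover have "inj_on (map_prod p p) (parcs (mat_graph B))"
    by (rule inj_on_subset[OF map_prod_inj_on[OF inj inj]]) (auto simp: mat_graph_def)
  ultimately have "pre_digraph.digraph_isomorphism (with_proj (mat_graph B)) ?h"
    using inj by (auto simp: pre_digraph.digraph_isomorphism_def mat_graph_def)
  moreover have "parcs G = map_prod p p ` parcs (mat_graph B)"
  proof (intro subset_antisym subsetI)
    fix e assume e: "e \<in> parcs G"
    then have "fst e \<in> p ` {..<dim_row B}" "snd e \<in> p ` {..<dim_row B}"
      unfolding V by (auto dest: G.arc_fst_in_verts G.arc_snd_in_verts)
    then obtain i j where "i < dim_row B" "j < dim_row B" "e = (p i, p j)"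
      by (metis imageE lessThan_iff prod.collapse)
    then show "e \<in> map_prod p p ` parcs (mat_graph B)"
      using e p(2)[of i j] by (auto simp: mat_graph_def intro!: rev_image_eqI[of "(i, j)"])
  qed (auto simp: mat_graph_def p(2))
  then have "with_proj G = app_iso ?h (with_proj (mat_graph B))"
    using V by (simp add: app_iso_def with_proj_def mat_graph_def)
  ultimately show ?L
    unfolding digraph_iso_def by blast
qed

text \<open>Sandwich: the columns indexed by \<open>S\<close> bound every admissible rank from
  below, and the Gram matrix of \<open>f\<close> attains the bound. Characteristic zero keeps
  nonzero integer products nonzero in the field.\<close>

lemma mr_plus_eqI:
  fixes G :: "'a pair_pre_digraph" and f :: "'a \<Rightarrow> 'i \<Rightarrow> int"
  assumes G: "pair_graph G" and S: "ordered_set (parcs G) S"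
    and I: "finite I" "represents I f G" "card S = card I"
  shows "mr_plus TYPE('f::{conjugatable_ordered_field, ring_char_0}) G = card S"
proof -
  interpret G: pair_graph G by fact
  define n where "n = card (pverts G)"
  define feasible :: "'f mat \<Rightarrow> bool" where
    "feasible B \<longleftrightarrow> B \<in> carrier_mat n n \<and> psd_mat B \<and>
       digraph_iso (with_proj (mat_graph B)) (with_proj G)" for B
  have lower: "card S \<le> vec_space.rank n B" if "feasible B" for B
  proof -
    have B: "B \<in> carrier_mat n n" "psd_mat B"
      using that by (auto simp: feasible_def)
    then have [simp]: "dim_row B = n" by auto
    have "digraph_iso (with_proj (mat_graph B)) (with_proj G)"
      using that by (simp add: feasible_def)
    then obtain p where p: "bij_betw p {..<n} (pverts G)"
      "\<And>i j. i < n \<Longrightarrow> j < n \<Longrightarrow> (p i, p j) \<in> parcs G \<longleftrightarrow> i \<noteq> j \<and> B $$ (i, j) \<noteq> 0"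
      unfolding digraph_iso_mat_graph_iff[OF G] by auto
    have sub: "parcs G \<subseteq> pverts G \<times> pverts G"
      using G.wellformed' by auto
    define J where "J = {i \<in> {..<n}. p i \<in> S}"
    have "S \<subseteq> p ` {..<n}"
      using ordered_set_subset_Range[OF S] sub bij_betw_imp_surj_on[OF p(1)] by auto
    then have "p ` J = S"
      by (auto simp: J_def)
    moreover have "inj_on p J"
      using p(1) by (auto simp: J_def bij_betw_def intro: inj_on_subset)
    ultimately have "card J = card S"
      using card_image[of p J] by simp
    moreover have "card J \<le> vec_space.rank n B"
    proof (rule rank_ge_card_columns[OF B(1)])
      fix x j assume x: "\<And>i. i < n \<Longrightarrow> (\<Sum>j\<in>J. B $$ (i, j) * x j) = 0" and j: "j \<in> J"
      \<comment> \<open>Extension by zero turns a relation among the columns in \<open>J\<close>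
        into a kernel vector of \<open>B\<close> supported on \<open>S\<close>.\<close>
      let ?x = "\<lambda>j. if j \<in> J then x j else 0"
      have "(\<Sum>j<n. B $$ (i, j) * ?x j) = 0" if "i < n" for i
      proof -
        have "(\<Sum>j<n. B $$ (i, j) * ?x j) = (\<Sum>j\<in>J. B $$ (i, j) * x j)"
          by (rule sum.mono_neutral_cong_right) (auto simp: J_def)
        then show ?thesis using x that by simp
      qed
      then have "?x j = 0"
        using kernel_ordered_set[OF S B(2), of p "pverts G" ?x j] p sub j by (auto simp: J_def)
      then show "x j = 0"
        using j by simp
    qed (auto simp: J_def)
    ultimately show ?thesis by simp
  qed
  obtain p where p: "bij_betw p {..<n} (pverts G)"
    using ex_bij_betw_nat_finite[OF G.pair_finite_verts] by (auto simp: n_def atLeast0LessThan)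
  define g :: "'i \<Rightarrow> nat \<Rightarrow> 'f" where "g k i = of_int (f (p i) k)" for k i
  define B where "B = mat n n (\<lambda>(i, j). \<Sum>k\<in>I. g k i * g k j)"
  have [simp]: "dim_row B = n" and B: "B \<in> carrier_mat n n"
    by (auto simp: B_def)
  have [simp]: "conjugate (g k i) = g k i" for k i
    by (simp add: g_def conjugate_of_int)
  have "hermitian_mat B"
    unfolding hermitian_mat_iff
    by (simp add: B_def sum_conjugate I(1) conjugate_dist_mul) (simp add: mult.commute)
  moreover have "0 \<le> (B *\<^sub>v x) \<bullet>c x" if "x \<in> carrier_vec n" for x
  proof -
    have "x = vec n (($) x)"
      using that by auto
    then have "(B *\<^sub>v x) \<bullet>c x = form B (($) x) (($) x)"
      using form_eq_scalar_prod[OF B] by metis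
    \<comment> \<open>Exchanging sums writes the form as a sum over coordinates \<open>k\<close> of
      terms \<open>s * conjugate s\<close>.\<close>
    also have "\<dots> = (\<Sum>i<n. \<Sum>j<n. \<Sum>k\<in>I. g k j * x $ j * conjugate (g k i * x $ i))"
      by (simp add: form_def B_def sum_distrib_right conjugate_dist_mul) (simp add: mult_ac)
    also have "\<dots> = (\<Sum>i<n. \<Sum>k\<in>I. \<Sum>j<n. g k j * x $ j * conjugate (g k i * x $ i))"
      by (intro sum.cong refl sum.swap)
    also have "\<dots> = (\<Sum>k\<in>I. \<Sum>i<n. \<Sum>j<n. g k j * x $ j * conjugate (g k i * x $ i))"
      by (rule sum.swap)
    also have "\<dots> = (\<Sum>k\<in>I. (\<Sum>j<n. g k j * x $ j) * conjugate (\<Sum>i<n. g k i * x $ i))"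
      by (simp add: sum_conjugate sum_distrib_left sum_distrib_right)
    also have "\<dots> \<ge> 0"
      by (intro sum_nonneg conjugate_square_positive)
    finally show ?thesis .
  qed
  ultimately have "psd_mat B"
    by (simp add: psd_mat_def)
  moreover have "(p i, p j) \<in> parcs G \<longleftrightarrow> i \<noteq> j \<and> B $$ (i, j) \<noteq> 0" if ij: "i < n" "j < n" for i j
  proof -
    have "B $$ (i, j) = of_int (\<Sum>k\<in>I. f (p i) k * f (p j) k)"
      using ij by (simp add: B_def g_def)
    moreover have "p i \<in> pverts G" "p j \<in> pverts G"
      using p ij by (auto simp: bij_betw_def)
    moreover have "p i \<noteq> p j" if "i \<noteq> j"
      using p ij that by (auto simp: bij_betw_def inj_on_def)
    moreover have "(p i, p j) \<notin> parcs G" if "i = j"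
      using that G.pair_no_loops[of "(p j, p j)"] by auto
    ultimately show ?thesis
      using I(2) by (cases "i = j") (simp_all add: represents_def del: of_int_sum)
  qed
  ultimately have "feasible B"
    using B p digraph_iso_mat_graph_iff[OF G, of B] unfolding feasible_def by auto
  moreover have "vec_space.rank n B \<le> card S"
    unfolding B_def I(3) by (rule rank_sum_products_le[OF I(1)])
  ultimately have "feasible B \<and> vec_space.rank n B = card S"
    using lower by (simp add: order_antisym)
  moreover have "mr_plus TYPE('f) G = (LEAST r. \<exists>B. feasible B \<and> vec_space.rank n B = r)"
    by (simp add: mr_plus_def feasible_def n_def conj_assoc)
  ultimately show ?thesis
    using lower by (auto intro: Least_equality)
qed

section \<open>Coronas\<close>

text \<open>Both bounds on the minimum rank of \<open>G\<close> equal \<open>k\<close>, with a vector \<open>h\<close> as needed for coronas.\<close>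

definition tight :: "nat \<Rightarrow> 'a pair_pre_digraph \<Rightarrow> bool" where
  "tight k G \<longleftrightarrow> pair_graph G \<and> (\<exists>S. ordered_set (parcs G) S \<and> card S = k) \<and>
     (\<exists>f h. represents {..<k} f G \<and> (\<forall>u \<in> pverts G. (\<Sum>i<k. h i * f u i) \<noteq> (0::int)))"

lemma parcs_corona_simps [simp]:
  "(Inl u, Inl v) \<in> parcs (corona G H) \<longleftrightarrow> (u, v) \<in> parcs G"
  "(Inl u, Inr (v, y)) \<in> parcs (corona G H) \<longleftrightarrow> u = v \<and> u \<in> pverts G \<and> y \<in> pverts H"
  "(Inr (u, x), Inl v) \<in> parcs (corona G H) \<longleftrightarrow> u = v \<and> u \<in> pverts G \<and> x \<in> pverts H"
  "(Inr (u, x), Inr (v, y)) \<in> parcs (corona G H) \<longleftrightarrow> u = v \<and> u \<in> pverts G \<and> (x, y) \<in> parcs H"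
  by (auto simp: corona_def)

text \<open>Copies over different vertices of \<open>G\<close> are not joined, so the OS-sets of the
  copies can be built one after another. While copy \<open>u\<close> is processed, the finished
  copies \<open>R\<close> lie outside the chosen union of components.\<close>

lemma ordered_set_corona_copies:
  fixes G :: "'a pair_pre_digraph" and H :: "'b pair_pre_digraph"
  assumes S: "ordered_set (parcs H) S" and "finite U" "U \<subseteq> pverts G"
  shows "ordered_set (parcs (corona G H)) (Inr ` (U \<times> S))"
  using assms(2,3)
proof induction
  case empty
  then show ?case by (simp add: ordered_set.empty)
next
  case (insert u U)
  define R where "R = (Inr ` (U \<times> S) :: ('a + 'a \<times> 'b) set)"
  have "ordered_set (parcs (corona G H)) (Inr ` ({u} \<times> S) \<union> R)"
    using S
  proof induction
    case empty
    then show ?case using insert by (simp add: R_def)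
  next
    case (insert S' v w C)
    have "ordered_set (parcs (corona G H)) (insert (Inr (u, v)) (Inr ` ({u} \<times> S') \<union> R))"
    proof (rule ordered_set.insert[where w = "Inr (u, w)" and C = "Inr ` ({u} \<times> C)"])
      fix x y :: "'a + 'a \<times> 'b"
      assume xy: "x \<in> insert (Inr (u, v)) (Inr ` ({u} \<times> C))"
        "y \<in> Inr ` ({u} \<times> S') \<union> R - Inr ` ({u} \<times> C)"
      then obtain x' a y' where "x = Inr (u, x')" "y = Inr (a, y')" "x' \<in> insert v C"
        "a = u \<longrightarrow> y' \<in> S' - C"
        using \<open>u \<notin> U\<close> by (auto simp: R_def)
      then show "(x, y) \<notin> parcs (corona G H)"
        using insert.hyps(5)[of x' y'] by auto
    qed (use insert \<open>u \<notin> U\<close> \<open>insert u U \<subseteq> pverts G\<close> in \<open>auto simp: R_def\<close>)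
    moreover have "Inr ` ({u} \<times> insert v S') \<union> R = insert (Inr (u, v)) (Inr ` ({u} \<times> S') \<union> R)"
      by auto
    ultimately show ?case by (simp only:)
  qed
  moreover have "Inr ` (insert u U \<times> S) = Inr ` ({u} \<times> S) \<union> R"
    by (auto simp: R_def)
  ultimately show ?case by (simp only:)
qed

text \<open>The copies come first, then \<open>S\<close> in its own order. A witness
  \<open>w\<close> for \<open>v\<close> in \<open>G\<close> still works: it lies outside
  \<open>insert v C\<close>, so \<open>Inl w\<close> is joined to none of the copies carried
  along.\<close>

lemma ordered_set_corona:
  assumes S: "ordered_set (parcs G) S" and T: "ordered_set (parcs H) T" and fin: "finite (pverts G)"
    and wf: "parcs G \<subseteq> pverts G \<times> pverts G"
  shows "ordered_set (parcs (corona G H)) (Inl ` S \<union> Inr ` (pverts G \<times> T))"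
  using S
proof induction
  case empty
  then show ?case
    using ordered_set_corona_copies[OF T fin] by simp
next
  case (insert S v w C)
  let ?R = "Inr ` (pverts G \<times> T)"
  \<comment> \<open>\<open>Inl v\<close> is adjacent to its whole copy, hence the copies over
    \<open>C\<close> and over \<open>v\<close> itself belong to the union of components.\<close>
  let ?C = "Inl ` C \<union> Inr ` (insert v C \<times> T)"
  have SV: "insert v S \<subseteq> pverts G"
    using ordered_set_subset_Range[OF insert.hyps(1)] insert.hyps(6) wf by auto
  have "ordered_set (parcs (corona G H)) (insert (Inl v) (Inl ` S \<union> ?R))"
  proof (rule ordered_set.insert[where w = "Inl w" and C = ?C])
    fix x y assume xy: "x \<in> insert (Inl v) ?C" "y \<in> Inl ` S \<union> ?R - ?C"
    from xy(2) consider y' where "y = Inl y'" "y' \<in> S - C"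
      | a b where "y = Inr (a, b)" "a \<notin> insert v C"
      by (auto simp: image_iff)
    then show "(x, y) \<notin> parcs (corona G H)"
    proof cases
      case 1
      then show ?thesis
        using xy(1) insert.hyps(2,5) by auto
    next
      case 2
      then show ?thesis
        using xy(1) by auto
    qed
  next
    show "?C \<subseteq> Inl ` S \<union> ?R"
      using insert.hyps(4) SV by auto
  qed (use insert in auto)
  then show ?case
    by simp
qed

lemma mr_plus_corona:
  assumes "tight k G" "tight l H"
  shows "mr_plus TYPE('f::{conjugatable_ordered_field, ring_char_0}) (corona G H) =
    card (pverts G) * l + k"
proof -
  interpret G: pair_graph G using assms by (simp add: tight_def)
  interpret H: pair_graph H using assms by (simp add: tight_def)
  have GH: "pair_graph (corona G H)"
    by (rule pair_graph_corona) unfold_locales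
  obtain S f where S: "ordered_set (parcs G) S" "card S = k" and f: "represents {..<k} f G"
    using assms(1) by (auto simp: tight_def)
  obtain T g h where T: "ordered_set (parcs H) T" "card T = l" and g: "represents {..<l} g H"
    and h: "\<And>x. x \<in> pverts H \<Longrightarrow> (\<Sum>i<l. h i * g x i) \<noteq> 0"
    using assms(2) by (auto simp: tight_def)
  let ?W = "Inl ` S \<union> Inr ` (pverts G \<times> T)"
  have fin: "finite (pverts G)" by (rule G.pair_finite_verts)
  have W: "ordered_set (parcs (corona G H)) ?W"
    using S(1) T(1) G.pair_finite_verts by (rule ordered_set_corona) (auto dest: G.wellformed')
  have "card ?W = card (Inl ` S :: ('a + 'a \<times> 'b) set) + card (Inr ` (pverts G \<times> T) :: ('a + 'a \<times> 'b) set)"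
    using finite_ordered_set[OF S(1)] finite_ordered_set[OF T(1)] fin
    by (intro card_Un_disjoint) auto
  then have cW: "card ?W = card (pverts G) * l + k"
    using S(2) T(2) by (simp add: card_image card_cartesian_product)
  \<comment> \<open>One block of \<open>k\<close> coordinates for \<open>G\<close> and one of
    \<open>l\<close> per vertex of \<open>G\<close>, matching the size of \<open>?W\<close>. Between
    \<open>Inl u\<close> and its copy only \<open>h\<close> against \<open>g x\<close> occurs,
    nonzero by the choice of \<open>h\<close>; different copies share no block.\<close>
  define I where "I = {..<k} <+> pverts G \<times> {..<l}"
  define F where "F a i = (case a of
      Inl u \<Rightarrow> (case i of Inl i \<Rightarrow> f u i | Inr (v, j) \<Rightarrow> of_bool (v = u) * h j)
    | Inr (u, x) \<Rightarrow> (case i of Inl i \<Rightarrow> 0 | Inr (v, j) \<Rightarrow> of_bool (v = u) * g x j))"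
    for a :: "'a + 'a \<times> 'b" and i :: "nat + 'a \<times> nat"
  have F: "(\<Sum>i\<in>I. F a i * F b i) = (\<Sum>i<k. F a (Inl i) * F b (Inl i)) +
      (\<Sum>v\<in>pverts G. \<Sum>j<l. F a (Inr (v, j)) * F b (Inr (v, j)))" for a b
    using fin by (simp add: I_def sum.Plus sum.cartesian_product)
  have delta: "(\<Sum>v\<in>pverts G. \<Sum>j<l. of_bool (v = u) * p j * (of_bool (v = u') * q j)) =
      of_bool (u = u') * (\<Sum>j<l. p j * q j)" if "u \<in> pverts G" for u u' and p q :: "nat \<Rightarrow> int"
  proof -
    have "(\<Sum>v\<in>pverts G. \<Sum>j<l. of_bool (v = u) * p j * (of_bool (v = u') * q j)) =
        (\<Sum>v\<in>pverts G. if v = u then of_bool (u = u') * (\<Sum>j<l. p j * q j) else 0)"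
      by (intro sum.cong refl) (auto simp: sum_distrib_left)
    then show ?thesis
      using fin that by simp
  qed
  have "represents I F (corona G H)"
    unfolding represents_def
  proof (intro ballI impI)
    fix a b assume ab: "a \<in> pverts (corona G H)" "b \<in> pverts (corona G H)" "a \<noteq> b"
    have vert: "(\<exists>u\<in>pverts G. a = Inl u) \<or> (\<exists>u\<in>pverts G. \<exists>x\<in>pverts H. a = Inr (u, x))"
      if "a \<in> pverts (corona G H)" for a
      using that by (auto simp: corona_def)
    have hh: "(\<Sum>i<l. g x i * h i) \<noteq> 0" if "x \<in> pverts H" for x
      using h[OF that] by (simp add: mult.commute)
    show "(a, b) \<in> parcs (corona G H) \<longleftrightarrow> (\<Sum>i\<in>I. F a i * F b i) \<noteq> 0"
      using vert[OF ab(1)] vert[OF ab(2)]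
    proof (elim disjE bexE)
      fix u v assume uv: "u \<in> pverts G" "a = Inl u" "v \<in> pverts G" "b = Inl v"
      then show ?thesis
        using f ab(3) by (auto simp: F) (auto simp: F_def delta represents_def)
    next
      fix u v y assume "u \<in> pverts G" "a = Inl u" "v \<in> pverts G" "y \<in> pverts H" "b = Inr (v, y)"
      then show ?thesis
        using h unfolding F by (simp add: F_def delta)
    next
      fix u x v assume "u \<in> pverts G" "x \<in> pverts H" "a = Inr (u, x)" "v \<in> pverts G" "b = Inl v"
      then show ?thesis
        using hh unfolding F by (simp add: F_def delta)
    next
      fix u x v y assume "u \<in> pverts G" "x \<in> pverts H" "a = Inr (u, x)"
        "v \<in> pverts G" "y \<in> pverts H" "b = Inr (v, y)"
      then show ?thesis
        using g ab(3) unfolding F by (auto simp: F_def delta represents_def)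
    qed
  qed
  moreover have "finite I" "card I = card (pverts G) * l + k"
    using fin by (simp_all add: I_def card_Plus card_cartesian_product)
  ultimately show ?thesis
    using mr_plus_eqI[OF GH W, where 'f = 'f, of I F] cW by simp
qed

section \<open>Complete graphs and cycles\<close>

text \<open>The constant vector 1 represents the graph in dimension one, and a single vertex is an
  OS-set because \<open>2 \<le> n\<close> provides a neighbour as witness.\<close>

lemma tight_complete:
  assumes K: "complete_digraph n (with_proj K)" and "2 \<le> n"
  shows "tight 1 K"
proof -
  have G: "pair_graph K"
    using K by (rule pair_graphI_complete)
  have V: "finite (pverts K)" "card (pverts K) = n"
    and E: "parcs K = {(u, v). (u, v) \<in> pverts K \<times> pverts K \<and> u \<noteq> v}"
    using K by (auto simp: complete_digraph_pair_def)
  obtain a b where ab: "a \<in> pverts K" "b \<in> pverts K" "a \<noteq> b"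
    using V assms(2) card_le_Suc0_iff_eq[OF V(1)] by (metis One_nat_def Suc_1 not_less_eq_eq)
  have "ordered_set (parcs K) {a}"
    by (rule ordered_set.insert[where w = b and C = "{}"]) (use ab E in \<open>auto intro: ordered_set.empty\<close>)
  then have "\<exists>S. ordered_set (parcs K) S \<and> card S = 1"
    by (intro exI[of _ "{a}"]) simp
  moreover have "represents {..<1::nat} (\<lambda>_ _. 1) K"
    by (auto simp: represents_def E)
  ultimately show ?thesis
    unfolding tight_def using G by (intro conjI exI[of _ "\<lambda>_ _. 1"] exI[of _ "\<lambda>_. 1"]) auto
qed

lemma tight_cycle:
  assumes "cycle_graph n C"
  shows "tight (n - 2) C"
proof -
  from assms obtain v where n: "3 \<le> n" and inj: "inj_on v {..<n}" and V: "pverts C = v ` {..<n}"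
    and E: "parcs C = (\<Union>i<n. {(v i, v (Suc i mod n)), (v (Suc i mod n), v i)})"
    by (auto simp: cycle_graph_def)
  have adj: "(v i, v j) \<in> parcs C \<longleftrightarrow> j = Suc i mod n \<or> i = Suc j mod n" if "i < n" "j < n" for i j
  proof -
    have [simp]: "v a = v b \<longleftrightarrow> a = b" if "a < n" "b < n" for a b
      using inj that by (auto dest: inj_onD)
    have [simp]: "Suc a mod n < n" for a
      using n by simp
    show ?thesis
      unfolding E using that by auto
  qed
  have next_neq: "Suc i mod n \<noteq> i" if "i < n" for i
    using that n by (cases "Suc i = n") auto
  have G: "pair_graph C"
  proof unfold_locales
    have lt: "Suc i mod n < n" for i
      using n by simp
    show "fst e \<in> pverts C" "snd e \<in> pverts C" if "e \<in> parcs C" for e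
      using that lt by (auto simp: E V)
    show "finite (pverts C)" "finite (parcs C)"
      by (auto simp: V E)
    show "symmetric (with_proj C)"
      by (auto simp: symmetric_def sym_def E)
    show "fst e \<noteq> snd e" if "e \<in> parcs C" for e
      using that next_neq inj lt by (fastforce simp: E dest: inj_onD)
  qed
  define d where "d = n - 2"
  have d: "n = Suc (Suc d)" "0 < d"
    using n by (auto simp: d_def)
  \<comment> \<open>Each \<open>v m\<close> is witnessed by its successor. Stopping at
    \<open>d\<close> keeps the witness away from \<open>v (Suc d)\<close>, which is also adjacent to
    \<open>v 0\<close>.\<close>
  have os: "ordered_set (parcs C) (v ` {..<m})" if "m \<le> d" for m
    using that
  proof (induction m)
    case 0
    then show ?case by (simp add: ordered_set.empty)
  next
    case (Suc m)
    have inj': "v a = v b \<longleftrightarrow> a = b" if "a < n" "b < n" for a b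
      using inj that by (auto dest: inj_onD)
    have "ordered_set (parcs C) (insert (v m) (v ` {..<m}))"
      by (rule ordered_set.insert[where w = "v (Suc m)" and C = "v ` {..<m}"])
        (use Suc d in \<open>auto simp: inj' adj\<close>)
    then show ?case
      by (simp add: lessThan_Suc)
  qed
  define P where "P i k = (of_bool (k = i) + of_bool (Suc k = i) :: int)" for i k :: nat
  \<comment> \<open>\<open>P i\<close> has ones at \<open>i - 1\<close> and \<open>i\<close>; the
    two conditions drop the entry that falls outside \<open>{..<d}\<close> for \<open>i = d\<close>
    and \<open>i = 0\<close>.\<close>
  have P: "(\<Sum>k<d. g k * P i k) = (if i < d then g i else 0) + (if 0 < i then g (i - 1) else 0)"
    if "i \<le> d" for g i
  proof -
    have "(\<Sum>k<d. g k * P i k) =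
        (\<Sum>k<d. if k = i then g k else 0) + (\<Sum>k<d. if k = i - 1 then of_bool (0 < i) * g k else 0)"
      unfolding sum.distrib[symmetric] by (intro sum.cong) (auto simp: P_def)
    then show ?thesis
      using that d by auto
  qed
  \<comment> \<open>The path \<open>v 0, \<dots>, v d\<close> gets the vectors \<open>e\<^bsub>i-1\<^esub> + e\<^bsub>i\<^esub>\<close> (without \<open>e\<^bsub>-1\<^esub>\<close> and \<open>e\<^bsub>d\<^esub>\<close>), and the
    last vertex the alternating vector, which is orthogonal to all of them except the two ends.\<close>
  define F where "F i k = (if i = Suc d then (- 1) ^ k else P i k)" for i k :: nat
  define f where "f a = F (the_inv_into {..<n} v a)" for a
  have f: "f (v i) = F i" if "i < n" for i
    using that inj by (simp add: f_def the_inv_into_f_f)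
  have lt: "(v i, v j) \<in> parcs C \<longleftrightarrow> (\<Sum>k<d. F i k * F j k) \<noteq> 0" if "i < j" "j < n" for i j
  proof (cases "j = Suc d")
    case True
    have "(\<Sum>k<d. F i k * F j k) = (\<Sum>k<d. (- 1) ^ k * P i k)"
      using True that by (intro sum.cong) (auto simp: F_def)
    also have "\<dots> = (if i < d then (- 1) ^ i else 0) + (if 0 < i then (- 1) ^ (i - 1) else 0)"
      using True that by (intro P) auto
    also have "\<dots> \<noteq> 0 \<longleftrightarrow> i = 0 \<or> i = d"
      using True that d by (cases i) auto
    finally show ?thesis
      using True that d adj[of i j] by auto
  next
    case False
    then have "(\<Sum>k<d. F i k * F j k) = (\<Sum>k<d. P j k * P i k)"
      using that d by (intro sum.cong) (auto simp: F_def)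
    also have "\<dots> = (if i < d then P j i else 0) + (if 0 < i then P j (i - 1) else 0)"
      using False that d by (intro P) auto
    also have "\<dots> \<noteq> 0 \<longleftrightarrow> j = Suc i"
      using False that d by (auto simp: P_def)
    finally show ?thesis
      using False that d adj[of i j] by auto
  qed
  have "represents {..<d} f C"
    unfolding represents_def V
  proof safe
    fix i j assume ij: "i < n" "j < n" "v i \<noteq> v j"
    have *: "(v i, v j) \<in> parcs C \<longleftrightarrow> (\<Sum>k<d. F i k * F j k) \<noteq> 0"
    proof (cases "i < j")
      case False
      then have "j < i"
        using ij by (metis linorder_neqE_nat)
      then show ?thesis
        using lt[of j i] adj[of i j] adj[of j i] ij by (auto simp: mult.commute)
    qed (use lt ij in auto)
    show "(\<Sum>k<d. f (v i) k * f (v j) k) = 0 \<Longrightarrow> (v i, v j) \<in> parcs C \<Longrightarrow> False"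
      "(\<Sum>k<d. f (v i) k * f (v j) k) \<noteq> 0 \<Longrightarrow> (v i, v j) \<in> parcs C"
      using * f ij by auto
  qed
  moreover have "\<exists>h. \<forall>u\<in>pverts C. (\<Sum>k<d. h k * f u k) \<noteq> 0"
  \<comment> \<open>The all-ones vector pairs with the alternating vector to 0 when \<open>d\<close>
    is even. Doubling the first entry adds 1 there, giving 1 or 2, and keeps the products with the
    \<open>P i\<close> positive.\<close>
  proof (intro exI[of _ "\<lambda>k. if k = 0 then 2 else 1"] ballI)
    let ?h = "\<lambda>k::nat. if k = 0 then 2 else (1::int)"
    fix u assume "u \<in> pverts C"
    then obtain i where i: "i < n" "u = v i"
      by (auto simp: V)
    show "(\<Sum>k<d. ?h k * f u k) \<noteq> 0"
    proof (cases "i = Suc d")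
      case True
      have "(\<Sum>k<m. (- 1) ^ k) = (of_bool (odd m) :: int)" for m
        by (induction m) auto
      moreover have "(\<Sum>k<d. ?h k * f u k) = (\<Sum>k<d. (if k = 0 then 1 else 0) + (- 1) ^ k)"
        using True i f by (intro sum.cong) (auto simp: F_def)
      ultimately show ?thesis
        using d by (simp add: sum.distrib)
    next
      case False
      then have "(\<Sum>k<d. ?h k * f u k) = (\<Sum>k<d. ?h k * P i k)"
        using i f by (simp add: F_def)
      also have "\<dots> = (if i < d then ?h i else 0) + (if 0 < i then ?h (i - 1) else 0)"
        using False i d by (intro P) auto
      also have "\<dots> > 0"
        using d by auto
      finally show ?thesis by simp
    qed
  qed
  moreover have "\<exists>S. ordered_set (parcs C) S \<and> card S = d"
    using os[of d] card_image[OF inj_on_subset[OF inj], of "{..<d}"] d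
    by (intro exI[of _ "v ` {..<d}"]) auto
  ultimately show ?thesis
    unfolding tight_def d_def[symmetric] using G by blast
qed

section \<open>Trees\<close>

lemma pawalk_append_arc:
  assumes "pcas v p u"
  shows "pcas v (p @ [(u, w)]) w" "pawalk_verts v (p @ [(u, w)]) = pawalk_verts v p @ [w]"
  using assms by (induction p arbitrary: v) auto

text \<open>Connectedness in the form of a cut: a path from \<open>s\<close> to \<open>t\<close> has
  to leave \<open>S\<close> somewhere.\<close>

lemma tree_crossing_arc:
  assumes "tree_graph G" "S \<subseteq> pverts G" "s \<in> S" "t \<in> pverts G - S"
  obtains a b where "a \<in> S" "b \<in> pverts G - S" "(a, b) \<in> parcs G"
proof -
  interpret G: pair_graph G using assms by (simp add: tree_graph_def)
  have "strongly_connected (with_proj G)"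
    using assms(1) G.pair_sym_arcs
    by (intro G.symmetric_connected_imp_strongly_connected) (auto simp: tree_graph_def)
  then have "s \<rightarrow>\<^sup>*\<^bsub>with_proj G\<^esub> t"
    using assms by (auto simp: strongly_connected_def)
  then have "(s, t) \<in> (parcs G)\<^sup>*"
    using reachable_rtranclI[of "with_proj G" s t] by simp
  then have "t \<in> S \<or> (\<exists>a b. a \<in> S \<and> b \<in> pverts G - S \<and> (a, b) \<in> parcs G)"
  proof (induction rule: rtrancl_induct)
    case (step y z)
    then show ?case
      using G.wellformed' by blast
  qed (use assms in auto)
  then show ?thesis
    using that assms by blast
qed

text \<open>A path inside \<open>S\<close> between two distinct neighbours of \<open>w\<close>,
  closed up through \<open>w\<close>, would be a forbidden cycle.\<close>

lemma tree_unique_neighbour: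
  assumes T: "tree_graph G" and w: "w \<notin> S" "(w, v) \<in> parcs G" "(u, w) \<in> parcs G"
    and path: "(v, u) \<in> (parcs G \<inter> S \<times> S)\<^sup>*" and "v \<in> S"
  shows "u = v"
proof (rule ccontr)
  assume "u \<noteq> v"
  interpret G: pair_graph G using T by (simp add: tree_graph_def)
  \<comment> \<open>Restricting to \<open>S\<close> before shortening the walk to a path guarantees
    that the path avoids \<open>w\<close>.\<close>
  define H where "H = \<lparr>pverts = S, parcs = parcs G \<inter> S \<times> S\<rparr>"
  interpret H: pair_wf_digraph H
    by unfold_locales (auto simp: H_def)
  have "v \<rightarrow>\<^sup>*\<^bsub>with_proj H\<^esub> u"
    using path
  proof (induction rule: rtrancl_induct)
    case base
    then show ?case
      using \<open>v \<in> S\<close> by (intro H.reachable_refl) (simp add: H_def)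
  next
    case (step y z)
    then show ?case
      by (intro H.reachable_adj_trans[of v y z]) (auto simp: H_def)
  qed
  then obtain p where "H.apath v p u"
    using H.reachable_apath by blast
  then have p: "set p \<subseteq> parcs G \<inter> S \<times> S" "pcas v p u" "distinct (pawalk_verts v p)"
    unfolding H.apath_def H.awalk_def by (auto simp: H_def)
  have "p \<noteq> []"
    using p(2) \<open>u \<noteq> v\<close> by auto
  have "set (pawalk_verts x p) \<subseteq> S" if "x \<in> S" for x
    using that p(1)
  proof (induction p arbitrary: x)
    case (Cons e p)
    then have "fst e \<in> S" "snd e \<in> S" "set p \<subseteq> parcs G \<inter> S \<times> S"
      by auto
    then show ?case
      using Cons.IH[of "snd e"] by simp
  qed simp
  then have "w \<notin> set (pawalk_verts v p)"
    using \<open>v \<in> S\<close> w(1) by blast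
  then have "G.cycle ((w, v) # p @ [(u, w)])"
    using p w(2,3) G.wellformed'(1)[OF w(2)]
    unfolding G.cycle_def G.awalk_def
    by (intro exI[of _ w]) (auto simp: pawalk_append_arc[OF p(2)] simp del: G.cas_append_iff)
  \<comment> \<open>Two arcs at \<open>w\<close> and at least one in \<open>p\<close>, so this is
    not one of the two-arc cycles that every edge produces.\<close>
  moreover have "3 \<le> length ((w, v) # p @ [(u, w)])"
    using \<open>p \<noteq> []\<close> by (cases p) auto
  ultimately show False
    using T unfolding tree_graph_def by blast
qed

text \<open>An arc crossing out of \<open>S\<close> gives the last vertex \<open>v\<close> and its
  witness \<open>w\<close>; acyclicity makes \<open>v\<close> the only neighbour of \<open>w\<close>
  in the component of \<open>v\<close>. Since \<open>S - {v}\<close> is again a proper subset,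
  induction applies.\<close>

lemma ordered_set_tree:
  assumes T: "tree_graph G" and "finite S" "S \<subset> pverts G"
  shows "ordered_set (parcs G) S"
  using assms(2,3)
proof (induction S rule: finite_psubset_induct)
  case (psubset S)
  interpret G: pair_graph G using T by (simp add: tree_graph_def)
  show ?case
  proof (cases "S = {}")
    case True
    then show ?thesis by (simp add: ordered_set.empty)
  next
    case False
    then obtain s t where "s \<in> S" "t \<in> pverts G - S"
      using psubset.prems by blast
    then obtain v w where v: "v \<in> S" and w: "w \<in> pverts G - S" and vw: "(v, w) \<in> parcs G"
      using tree_crossing_arc[OF T] psubset.prems by blast
    have wv: "(w, v) \<in> parcs G"
      using vw G.arcs_symmetric by blast
    define R where "R = parcs G \<inter> S \<times> S"
    define C where "C = {u \<in> S - {v}. (v, u) \<in> R\<^sup>*}"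
    have "ordered_set (parcs G) (insert v (S - {v}))"
    proof (rule ordered_set.insert[where w = w and C = C])
      show "ordered_set (parcs G) (S - {v})"
        using psubset v by blast
    next
      fix x y assume xy: "x \<in> insert v C" "y \<in> S - {v} - C"
      show "(x, y) \<notin> parcs G"
      proof
        assume "(x, y) \<in> parcs G"
        moreover have "x \<in> S" "(v, x) \<in> R\<^sup>*"
          using xy(1) v by (auto simp: C_def)
        ultimately have "(v, y) \<in> R\<^sup>*"
          using xy(2) by (auto simp: R_def intro: rtrancl_into_rtrancl)
        then show False
          using xy(2) by (auto simp: C_def)
      qed
    next
      fix u assume u: "u \<in> C"
      show "(w, u) \<notin> parcs G"
      proof
        assume "(w, u) \<in> parcs G"
        then have "(u, w) \<in> parcs G"
          using G.arcs_symmetric by blast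
        then have "u = v"
          using u v w wv by (intro tree_unique_neighbour[OF T, of w S]) (auto simp: C_def R_def)
        then show False
          using u by (simp add: C_def)
      qed
    qed (use v w wv in \<open>auto simp: C_def\<close>)
    then show ?thesis
      using v by (simp add: insert_absorb)
  qed
qed

text \<open>
  The tree is grown one vertex at a time; the arc joining a new vertex to the old ones gets a
  coordinate of its own, so that in the end \<open>f u\<close> is the indicator of the edges at \<open>u\<close>.
\<close>

lemma tree_grow:
  assumes T: "tree_graph G" and "Suc k \<le> card (pverts G)"
  shows "\<exists>S f. S \<subseteq> pverts G \<and> card S = Suc k \<and>
    (\<forall>u\<in>S. \<forall>v\<in>S. (u, v) \<in> (parcs G \<inter> S \<times> S)\<^sup>*) \<and>
    (\<forall>u i. 0 \<le> f u i) \<and> represents {..<k} f (G\<lparr>pverts := S\<rparr>)"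
  using assms(2)
proof (induction k)
  case 0
  then obtain r where "r \<in> pverts G"
    by (metis card.empty ex_in_conv not_less_eq_eq order_refl)
  then show ?case
    by (intro exI[of _ "{r}"] exI[of _ "\<lambda>_ _. 0"]) (auto simp: represents_def)
next
  case (Suc k)
  interpret G: pair_graph G using T by (simp add: tree_graph_def)
  obtain S f where S: "S \<subseteq> pverts G" "card S = Suc k"
    and conn: "\<And>u v. u \<in> S \<Longrightarrow> v \<in> S \<Longrightarrow> (u, v) \<in> (parcs G \<inter> S \<times> S)\<^sup>*"
    and f: "\<And>u i. 0 \<le> f u i" "represents {..<k} f (G\<lparr>pverts := S\<rparr>)"
    using Suc.IH[OF Suc_leD[OF Suc.prems]] by blast
  have "S \<noteq> pverts G"
    using S Suc.prems by auto
  moreover have "S \<noteq> {}"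
    using S by auto
  ultimately obtain p w where p: "p \<in> S" and w: "w \<in> pverts G - S" and pw: "(p, w) \<in> parcs G"
    using tree_crossing_arc[OF T] S(1) by blast
  have wp: "(w, p) \<in> parcs G"
    using pw G.arcs_symmetric by blast
  \<comment> \<open>As \<open>S\<close> is connected, a second neighbour of \<open>w\<close> in
    \<open>S\<close> would close a cycle.\<close>
  have nb: "(u, w) \<in> parcs G \<longleftrightarrow> u = p" "(w, u) \<in> parcs G \<longleftrightarrow> u = p" if "u \<in> S" for u
  proof -
    have "u = p" if "(u, w) \<in> parcs G"
      using tree_unique_neighbour[OF T _ wp that conn[OF p \<open>u \<in> S\<close>] p] w by blast
    then show "(u, w) \<in> parcs G \<longleftrightarrow> u = p" "(w, u) \<in> parcs G \<longleftrightarrow> u = p"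
      using pw wp G.arcs_symmetric by blast+
  qed
  let ?S = "insert w S"
  let ?R = "parcs G \<inter> ?S \<times> ?S"
  have old: "(u, v) \<in> ?R\<^sup>*" if "u \<in> S" "v \<in> S" for u v
    using conn[OF that] rtrancl_mono[of "parcs G \<inter> S \<times> S" ?R] by blast
  have new: "(p, w) \<in> ?R" "(w, p) \<in> ?R"
    using p pw wp by auto
  have conn': "(u, v) \<in> ?R\<^sup>*" if "u \<in> ?S" "v \<in> ?S" for u v
  proof -
    have "(u, p) \<in> ?R\<^sup>*" "(p, v) \<in> ?R\<^sup>*"
      using that old p new by auto
    then show ?thesis by (rule rtrancl_trans)
  qed
  define f' where "f' u i = (if i = k then of_bool (u = p \<or> u = w) else if u = w then 0 else f u i)"
    for u i
  have *: "(\<Sum>i<Suc k. f' u i * f' v i) = (\<Sum>i<k. if u = w \<or> v = w then 0 else f u i * f v i) +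
      of_bool ((u = p \<or> u = w) \<and> (v = p \<or> v = w))" for u v
  proof -
    have "(\<Sum>i<k. f' u i * f' v i) = (\<Sum>i<k. if u = w \<or> v = w then 0 else f u i * f v i)"
      by (intro sum.cong) (auto simp: f'_def)
    moreover have "f' u k * f' v k = of_bool ((u = p \<or> u = w) \<and> (v = p \<or> v = w))"
      by (auto simp: f'_def)
    ultimately show ?thesis
      by (simp only: sum.lessThan_Suc)
  qed
  \<comment> \<open>\<open>represents\<close> reads arcs only between listed vertices, so updating
    \<open>pverts\<close> alone amounts to passing to the induced subgraph.\<close>
  have "represents {..<Suc k} f' (G\<lparr>pverts := ?S\<rparr>)"
    unfolding represents_def
  proof (intro ballI impI)
    fix u v assume uv: "u \<in> pverts (G\<lparr>pverts := ?S\<rparr>)" "v \<in> pverts (G\<lparr>pverts := ?S\<rparr>)" "u \<noteq> v"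
    then consider "u \<in> S" "v \<in> S" | "u \<in> S" "v = w" | "u = w" "v \<in> S"
      by auto
    then show "(u, v) \<in> parcs (G\<lparr>pverts := ?S\<rparr>) \<longleftrightarrow> (\<Sum>i<Suc k. f' u i * f' v i) \<noteq> 0"
    proof cases
      case 1
      then have "u \<noteq> w" "v \<noteq> w"
        using w by auto
      then show ?thesis
        using 1 uv(3) f(2) unfolding * by (auto simp: represents_def)
    next
      case 2
      then show ?thesis
        unfolding * using w nb by auto
    next
      case 3
      then show ?thesis
        unfolding * using w nb by auto
    qed
  qed
  moreover have "\<forall>u i. 0 \<le> f' u i"
    using f(1) by (auto simp: f'_def)
  moreover have "card ?S = Suc (Suc k)"
    using S w finite_subset[OF S(1) G.pair_finite_verts] by auto
  moreover have "?S \<subseteq> pverts G"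
    using S w by auto
  ultimately show ?case
    using conn' by (intro exI[of _ ?S] exI[of _ f']) blast
qed

lemma tight_tree:
  assumes T: "tree_graph G" and m: "card (pverts G) = m" "2 \<le> m"
  shows "tight (m - 1) G"
proof -
  interpret G: pair_graph G using T by (simp add: tree_graph_def)
  have G: "pair_graph G" by unfold_locales
  have fin: "finite (pverts G)" by (rule G.pair_finite_verts)
  obtain r where r: "r \<in> pverts G"
    using m by fastforce
  have os: "ordered_set (parcs G) (pverts G - {r})"
    using T fin r by (intro ordered_set_tree) auto
  obtain S f where S: "S \<subseteq> pverts G" "card S = m"
    and f: "\<And>u i. 0 \<le> f u i" "represents {..<m - 1} f (G\<lparr>pverts := S\<rparr>)"
    using tree_grow[OF T, of "m - 1"] m by auto
  have "S = pverts G"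
    using card_subset_eq[OF fin S(1)] S(2) m(1) by simp
  then have rep: "represents {..<m - 1} f G"
    using f(2) by simp
  \<comment> \<open>The vector \<open>h\<close> is all ones: as \<open>f\<close> is nonnegative, a
    zero product forces every \<open>f u i\<close> to be 0, impossible since \<open>u\<close> has a
    neighbour.\<close>
  have "(\<Sum>i<m - 1. 1 * f u i) \<noteq> 0" if u: "u \<in> pverts G" for u
  proof
    assume "(\<Sum>i<m - 1. 1 * f u i) = 0"
    then have 0: "f u i = 0" if "i < m - 1" for i
      using that f(1) by (simp add: sum_nonneg_eq_0_iff)
    have "pverts G \<noteq> {u}"
      using m by auto
    then obtain t where "t \<in> pverts G - {u}"
      using u by blast
    then obtain v where "v \<in> pverts G - {u}" "(u, v) \<in> parcs G"
      using tree_crossing_arc[OF T, of "{u}" u t] u by auto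
    then have "(\<Sum>i<m - 1. f u i * f v i) \<noteq> 0"
      using rep u by (auto simp: represents_def)
    then show False
      using 0 by simp
  qed
  moreover have "card (pverts G - {r}) = m - 1"
    using fin r m by simp
  ultimately show ?thesis
    unfolding tight_def using G os rep
    by (intro conjI exI[of _ "pverts G - {r}"] exI[of _ f] exI[of _ "\<lambda>_. 1"]) auto
qed

section \<open>The nine families\<close>

text \<open>The equation for \<open>r\<close> is a separate premise, so that each family only has to
  match its closed form with \<open>n * l + k\<close> in natural-number arithmetic.\<close>

lemma has_mr_plus_corona:
  assumes "tight k G" "tight l H" "card (pverts G) = n" "r = n * l + k"
  shows "has_mr_plus (corona G H) r"
  using assms(3,4) mr_plus_corona[OF assms(1,2), where 'f = real]
    mr_plus_corona[OF assms(1,2), where 'f = complex]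
  by (simp add: has_mr_plus_def)

lemma card_complete_digraph: "complete_digraph n (with_proj K) \<Longrightarrow> card (pverts K) = n"
  by (simp add: complete_digraph_pair_def)

lemma card_cycle_graph: "cycle_graph n C \<Longrightarrow> card (pverts C) = n"
  by (auto simp: cycle_graph_def card_image)

theorem corollary3p13:
  shows
    "(\<forall>(T :: 'a pair_pre_digraph) (T' :: 'b pair_pre_digraph) m m'.
        tree_graph T \<and> card (pverts T) = m \<and> 2 \<le> m \<and>
        tree_graph T' \<and> card (pverts T') = m' \<and> 2 \<le> m' \<longrightarrow>
        has_mr_plus (T \<odot> T') (m * m' - 1)) \<and>
     (\<forall>(T :: 'a pair_pre_digraph) (K :: 'b pair_pre_digraph) m n.
        tree_graph T \<and> card (pverts T) = m \<and> 2 \<le> m \<and>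
        complete_digraph n (with_proj K) \<and> 2 \<le> n \<longrightarrow>
        has_mr_plus (T \<odot> K) (2 * m - 1)) \<and>
     (\<forall>(K :: 'a pair_pre_digraph) (T :: 'b pair_pre_digraph) n m.
        complete_digraph n (with_proj K) \<and> 2 \<le> n \<and>
        tree_graph T \<and> card (pverts T) = m \<and> 2 \<le> m \<longrightarrow>
        has_mr_plus (K \<odot> T) (n * m - n + 1)) \<and>
     (\<forall>(K :: 'a pair_pre_digraph) (K' :: 'b pair_pre_digraph) n m.
        complete_digraph n (with_proj K) \<and> 2 \<le> n \<and>
        complete_digraph m (with_proj K') \<and> 2 \<le> m \<longrightarrow>
        has_mr_plus (K \<odot> K') (n + 1)) \<and>
     (\<forall>(C :: 'a pair_pre_digraph) (T :: 'b pair_pre_digraph) n m.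
        cycle_graph n C \<and> 3 \<le> n \<and>
        tree_graph T \<and> card (pverts T) = m \<and> 2 \<le> m \<longrightarrow>
        has_mr_plus (C \<odot> T) (n * m - 2)) \<and>
     (\<forall>(T :: 'a pair_pre_digraph) (C :: 'b pair_pre_digraph) m n.
        tree_graph T \<and> card (pverts T) = m \<and> 2 \<le> m \<and>
        cycle_graph n C \<and> 3 \<le> n \<longrightarrow>
        has_mr_plus (T \<odot> C) (m * (n - 1) - 1)) \<and>
     (\<forall>(C :: 'a pair_pre_digraph) (K :: 'b pair_pre_digraph) n m.
        cycle_graph n C \<and> 3 \<le> n \<and>
        complete_digraph m (with_proj K) \<and> 2 \<le> m \<longrightarrow>
        has_mr_plus (C \<odot> K) (2 * n - 2)) \<and>
     (\<forall>(K :: 'a pair_pre_digraph) (C :: 'b pair_pre_digraph) m n.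
        complete_digraph m (with_proj K) \<and> 2 \<le> m \<and>
        cycle_graph n C \<and> 3 \<le> n \<longrightarrow>
        has_mr_plus (K \<odot> C) (m * (n - 2) + 1)) \<and>
     (\<forall>(C :: 'a pair_pre_digraph) (C' :: 'b pair_pre_digraph) n m.
        cycle_graph n C \<and> 3 \<le> n \<and>
        cycle_graph m C' \<and> 3 \<le> m \<longrightarrow>
        has_mr_plus (C \<odot> C') (n * (m - 1) - 2))"
proof (intro conjI allI impI; elim conjE)
  fix T :: "'a pair_pre_digraph" and T' :: "'b pair_pre_digraph" and m m'
  assume T: "tree_graph T" "card (pverts T) = m" "2 \<le> m"
    and T': "tree_graph T'" "card (pverts T') = m'" "2 \<le> m'"
  show "has_mr_plus (T \<odot> T') (m * m' - 1)"
    using T(3) T'(3) by (intro has_mr_plus_corona[OF tight_tree[OF T] tight_tree[OF T'] T(2)])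
      (simp add: diff_mult_distrib2)
next
  fix T :: "'a pair_pre_digraph" and K :: "'b pair_pre_digraph" and m n
  assume T: "tree_graph T" "card (pverts T) = m" "2 \<le> m"
    and K: "complete_digraph n (with_proj K)" "2 \<le> n"
  show "has_mr_plus (T \<odot> K) (2 * m - 1)"
    using T(3) by (intro has_mr_plus_corona[OF tight_tree[OF T] tight_complete[OF K] T(2)]) simp
next
  fix K :: "'a pair_pre_digraph" and T :: "'b pair_pre_digraph" and n m
  assume K: "complete_digraph n (with_proj K)" "2 \<le> n"
    and T: "tree_graph T" "card (pverts T) = m" "2 \<le> m"
  show "has_mr_plus (K \<odot> T) (n * m - n + 1)"
    by (intro has_mr_plus_corona[OF tight_complete[OF K] tight_tree[OF T] card_complete_digraph[OF K(1)]])
      (simp add: diff_mult_distrib2)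
next
  fix K :: "'a pair_pre_digraph" and K' :: "'b pair_pre_digraph" and n m
  assume K: "complete_digraph n (with_proj K)" "2 \<le> n"
    and K': "complete_digraph m (with_proj K')" "2 \<le> m"
  show "has_mr_plus (K \<odot> K') (n + 1)"
    by (intro has_mr_plus_corona[OF tight_complete[OF K] tight_complete[OF K']
        card_complete_digraph[OF K(1)]]) simp
next
  fix C :: "'a pair_pre_digraph" and T :: "'b pair_pre_digraph" and n m
  assume C: "cycle_graph n C" "3 \<le> n"
    and T: "tree_graph T" "card (pverts T) = m" "2 \<le> m"
  \<comment> \<open>Natural subtraction truncates: \<open>n \<le> n * m\<close> serves to rewrite
    \<open>n * (m - 1) + (n - 2)\<close> as \<open>n * m - 2\<close>.\<close>
  have "n * 1 \<le> n * m"
    using T(3) by (intro mult_le_mono) auto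
  then show "has_mr_plus (C \<odot> T) (n * m - 2)"
    using C(2) by (intro has_mr_plus_corona[OF tight_cycle[OF C(1)] tight_tree[OF T]
        card_cycle_graph[OF C(1)]]) (simp add: diff_mult_distrib2)
next
  fix T :: "'a pair_pre_digraph" and C :: "'b pair_pre_digraph" and m n
  assume T: "tree_graph T" "card (pverts T) = m" "2 \<le> m"
    and C: "cycle_graph n C" "3 \<le> n"
  \<comment> \<open>Exposes \<open>m * (n - 1)\<close> as \<open>m * (n - 2) + m\<close>, so that
    the remaining \<open>- 1\<close> comes from the tree.\<close>
  have "n - 1 = Suc (n - 2)"
    using C(2) by simp
  then show "has_mr_plus (T \<odot> C) (m * (n - 1) - 1)"
    using T(3) by (intro has_mr_plus_corona[OF tight_tree[OF T] tight_cycle[OF C(1)] T(2)]) simp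
next
  fix C :: "'a pair_pre_digraph" and K :: "'b pair_pre_digraph" and n m
  assume C: "cycle_graph n C" "3 \<le> n"
    and K: "complete_digraph m (with_proj K)" "2 \<le> m"
  show "has_mr_plus (C \<odot> K) (2 * n - 2)"
    using C(2) by (intro has_mr_plus_corona[OF tight_cycle[OF C(1)] tight_complete[OF K]
        card_cycle_graph[OF C(1)]]) simp
next
  fix K :: "'a pair_pre_digraph" and C :: "'b pair_pre_digraph" and m n
  assume K: "complete_digraph m (with_proj K)" "2 \<le> m"
    and C: "cycle_graph n C" "3 \<le> n"
  show "has_mr_plus (K \<odot> C) (m * (n - 2) + 1)"
    by (intro has_mr_plus_corona[OF tight_complete[OF K] tight_cycle[OF C(1)]
        card_complete_digraph[OF K(1)]]) simp
next
  fix C :: "'a pair_pre_digraph" and C' :: "'b pair_pre_digraph" and n m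
  assume C: "cycle_graph n C" "3 \<le> n" and C': "cycle_graph m C'" "3 \<le> m"
  have "m - 1 = Suc (m - 2)"
    using C'(2) by simp
  then show "has_mr_plus (C \<odot> C') (n * (m - 1) - 2)"
    using C(2) by (intro has_mr_plus_corona[OF tight_cycle[OF C(1)] tight_cycle[OF C'(1)]
        card_cycle_graph[OF C(1)]]) simp
qed

end
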